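(* Let $K\ge 1$, let $S$ be a discrete set, let $X\subseteq 2^S$ be a set of feasible solutions (each a finite subset of $S$), and let $o:S\to\mathcal{C}=\{\eta_1,\dots,\eta_K\}$ assign to each element of $S$ one of $K$ ordered categories $\eta_1\prec\cdots\prec\eta_K$. Let $x',\hat x\in X$ be two feasible solutions. Then $x'$ ordinally dominates $\hat x$ if and only if $x'$ tail-dominates $\hat x$.
   Context: Category $\eta_i$ is strictly preferred over $\eta_{i+1}$, written $\eta_i\prec\eta_{i+1}$. For a feasible solution $x=\{e_1,\dots,e_n\}\in X$ (with distinct $e_i$; $n$ may vary with $x$), the counting vector $c(x)\in\mathbb{Z}^K$ has components $c_i(x)=|\{e\in x: o(e)=\eta_i\}|$. A numerical representation is a function $\nu:\mathcal{C}\to\mathbb{Z}_{\ge 0}$ (non-negative integers) with $\eta_i\prec\eta_j\iff\nu(\eta_i)<\nu(\eta_j)$ for all $i,j$; $\mathcal{V}$ is the set of all numerical representations. Put $\nu(x)=\sum_{i=1}^n\nu(o(e_i))=\sum_{i=1}^K\nu(\eta_i)c_i(x)$. The solution $x'$ weakly ordinally dominates $\hat x$ if $\nu(x')\le\nu(\hat x)$ for every $\nu\in\mathcal{V}$; $x'$ ordinally dominates $\hat x$ if it weakly ordinally dominates $\hat x$ and there exists $\nu^*\in\mathcal{V}$ with $\nu^*(x')<\nu^*(\hat x)$. The solution $x'$ tail-dominates $\hat x$ if $\sum_{i=j}^K c_i(x')\le\sum_{i=j}^K c_i(\hat x)$ for all $j=1,\dots,K$ and $c(x')\ne c(\hat x)$.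 *)

theory Defs
  imports Main "HOL-Library.FuncSet"
begin

(* The order on categories is the strict order of the type 'c; the categories
   are the values \<eta> 1, ..., \<eta> K of an enumeration \<eta> that is strictly increasing
   on {1..K}, a smaller category being a preferred one. The map cat sends an
   element to its category. *)

(* Extensional on {1..K}, so that equality of functions is equality of vectors
   with K components. *)
definition count_vec :: "nat \<Rightarrow> (nat \<Rightarrow> 'c) \<Rightarrow> ('a \<Rightarrow> 'c) \<Rightarrow> 'a set \<Rightarrow> nat \<Rightarrow> int" where
  "count_vec K \<eta> cat x = (\<lambda>i\<in>{1..K}. int (card {e \<in> x. cat e = \<eta> i}))"

(* Values outside the set of categories are unconstrained and never used. *)
definition num_reps :: "nat \<Rightarrow> (nat \<Rightarrow> 'c::order) \<Rightarrow> ('c \<Rightarrow> nat) set" where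
  "num_reps K \<eta> = {\<nu>. \<forall>i\<in>{1..K}. \<forall>j\<in>{1..K}. \<eta> i < \<eta> j \<longleftrightarrow> \<nu> (\<eta> i) < \<nu> (\<eta> j)}"

definition num_value :: "('a \<Rightarrow> 'c) \<Rightarrow> ('c \<Rightarrow> nat) \<Rightarrow> 'a set \<Rightarrow> nat" where
  "num_value cat \<nu> x = (\<Sum>e\<in>x. \<nu> (cat e))"

definition weakly_ordinally_dominates ::
  "nat \<Rightarrow> (nat \<Rightarrow> 'c::order) \<Rightarrow> ('a \<Rightarrow> 'c) \<Rightarrow> 'a set \<Rightarrow> 'a set \<Rightarrow> bool" where
  "weakly_ordinally_dominates K \<eta> cat x y \<longleftrightarrow>
     (\<forall>\<nu>\<in>num_reps K \<eta>. num_value cat \<nu> x \<le> num_value cat \<nu> y)"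

definition ordinally_dominates ::
  "nat \<Rightarrow> (nat \<Rightarrow> 'c::order) \<Rightarrow> ('a \<Rightarrow> 'c) \<Rightarrow> 'a set \<Rightarrow> 'a set \<Rightarrow> bool" where
  "ordinally_dominates K \<eta> cat x y \<longleftrightarrow>
     weakly_ordinally_dominates K \<eta> cat x y \<and>
     (\<exists>\<nu>\<in>num_reps K \<eta>. num_value cat \<nu> x < num_value cat \<nu> y)"

definition tail_dominates ::
  "nat \<Rightarrow> (nat \<Rightarrow> 'c) \<Rightarrow> ('a \<Rightarrow> 'c) \<Rightarrow> 'a set \<Rightarrow> 'a set \<Rightarrow> bool" where
  "tail_dominates K \<eta> cat x y \<longleftrightarrow>
     (\<forall>j\<in>{1..K}. (\<Sum>i=j..K. count_vec K \<eta> cat x i) \<le> (\<Sum>i=j..K. count_vec K \<eta> cat y i)) \<and>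
     count_vec K \<eta> cat x \<noteq> count_vec K \<eta> cat y"

end

theory Submission
  imports Defs
begin

text \<open>
  Write \<open>T\<^sub>j(x)\<close> for the tail \<open>c\<^sub>j(x) + \<dots> + c\<^sub>K(x)\<close> of the counting vector. Summation by parts
  turns the value of a solution into a combination of its tails,
  \<open>\<nu>(x) = (\<Sum>j=1..K. w\<^sub>j * T\<^sub>j(x))\<close>, where \<open>w\<^sub>j = \<nu>(\<eta>\<^sub>j) - \<nu>(\<eta>\<^sub>j\<^sub>-\<^sub>1)\<close> are the increments of \<open>\<nu>\<close>
  along the categories (and \<open>w\<^sub>1 = \<nu>(\<eta>\<^sub>1)\<close>). The increments of a numerical representation are
  nonnegative (\<open>num_rep_weights\<close>), and conversely every sequence of positive integers occurs as the
  increments of one (\<open>weights_num_rep\<close>). The theorem compares the two dominance relations through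
  these weights.

  Smaller tails give smaller values for all nonnegative weights, and if some tail is strictly
  smaller, which happens as soon as the counting vectors differ, then the weights \<open>w\<^sub>j = 1\<close> witness
  strictness. Conversely, if \<open>T\<^sub>j\<close> were larger for the dominating solution, then concentrating a
  large weight on \<open>j\<close> would let this single term outweigh all the others and so
  contradict weak dominance.
\<close>

definition tail_count :: "nat \<Rightarrow> (nat \<Rightarrow> 'c) \<Rightarrow> ('a \<Rightarrow> 'c) \<Rightarrow> 'a set \<Rightarrow> nat \<Rightarrow> int" where
  "tail_count K \<eta> cat x j = (\<Sum>i=j..K. count_vec K \<eta> cat x i)"

lemma count_vec_nonneg: "i \<in> {1..K} \<Longrightarrow> 0 \<le> count_vec K \<eta> cat x i"
  by (simp add: count_vec_def)

lemma tail_count_nonneg: "1 \<le> j \<Longrightarrow> 0 \<le> tail_count K \<eta> cat x j"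
  unfolding tail_count_def by (rule sum_nonneg) (rule count_vec_nonneg, simp)

text \<open>
  The counting vector is recovered from its tails by \<open>c\<^sub>j = T\<^sub>j - T\<^sub>j\<^sub>+\<^sub>1\<close>, so different counting
  vectors have a different tail.
\<close>

lemma count_vec_eqI_tail_count:
  assumes "\<And>j. j \<in> {1..K} \<Longrightarrow> tail_count K \<eta> cat x j = tail_count K \<eta> cat y j"
  shows "count_vec K \<eta> cat x = count_vec K \<eta> cat y"
proof
  fix i
  show "count_vec K \<eta> cat x i = count_vec K \<eta> cat y i"
  proof (cases "i \<in> {1..K}")
    case True
    have split: "tail_count K \<eta> cat z i = count_vec K \<eta> cat z i + tail_count K \<eta> cat z (Suc i)" for z
      using True by (simp add: tail_count_def sum.atLeast_Suc_atMost)
    have "tail_count K \<eta> cat x (Suc i) = tail_count K \<eta> cat y (Suc i)"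
    proof (cases "i = K")
      case True
      then show ?thesis by (simp add: tail_count_def)
    next
      case False
      then show ?thesis using \<open>i \<in> {1..K}\<close> assms[of "Suc i"] by auto
    qed
    then show ?thesis using assms[OF True] split[of x] split[of y] by simp
  next
    case False
    then show ?thesis by (auto simp: count_vec_def)
  qed
qed

lemma sum_by_parts_tails:
  fixes w c :: "nat \<Rightarrow> 'b::comm_semiring_0"
  shows "(\<Sum>i=1..K. (\<Sum>j=1..i. w j) * c i) = (\<Sum>j=1..K. w j * (\<Sum>i=j..K. c i))"
proof -
  have "(\<Sum>i=1..K. (\<Sum>j=1..i. w j) * c i)
      = (\<Sum>i\<in>{1..K}. \<Sum>j\<in>{j\<in>{1..K}. j \<le> i}. w j * c i)"
    by (auto simp: sum_distrib_right intro!: sum.cong)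
  also have "\<dots> = (\<Sum>j\<in>{1..K}. \<Sum>i\<in>{i\<in>{1..K}. j \<le> i}. w j * c i)"
    by (rule sum.swap_restrict) auto
  also have "\<dots> = (\<Sum>j=1..K. w j * (\<Sum>i=j..K. c i))"
    by (auto simp: sum_distrib_left intro!: sum.cong)
  finally show ?thesis .
qed

lemma num_value_eq_sum_count_vec:
  assumes "finite x" "inj_on \<eta> {1..K}" "cat ` x \<subseteq> \<eta> ` {1..K}"
  shows "int (num_value cat \<nu> x) = (\<Sum>i=1..K. int (\<nu> (\<eta> i)) * count_vec K \<eta> cat x i)"
proof -
  have "num_value cat \<nu> x = (\<Sum>c\<in>\<eta> ` {1..K}. \<Sum>e\<in>{e\<in>x. cat e = c}. \<nu> (cat e))"
    unfolding num_value_def using assms by (intro sum.group[symmetric]) auto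
  also have "\<dots> = (\<Sum>i=1..K. \<Sum>e\<in>{e\<in>x. cat e = \<eta> i}. \<nu> (cat e))"
    using assms(2) by (simp add: sum.reindex)
  also have "\<dots> = (\<Sum>i=1..K. \<nu> (\<eta> i) * card {e\<in>x. cat e = \<eta> i})"
    by (auto intro!: sum.cong)
  finally show ?thesis by (auto simp: count_vec_def intro!: sum.cong)
qed

lemma num_value_eq_sum_tail_count:
  assumes "finite x" "inj_on \<eta> {1..K}" "cat ` x \<subseteq> \<eta> ` {1..K}"
    and "\<And>i. i \<in> {1..K} \<Longrightarrow> \<nu> (\<eta> i) = (\<Sum>j=1..i. w j)"
  shows "int (num_value cat \<nu> x) = (\<Sum>j=1..K. int (w j) * tail_count K \<eta> cat x j)"
proof -
  have "int (num_value cat \<nu> x) = (\<Sum>i=1..K. (\<Sum>j=1..i. int (w j)) * count_vec K \<eta> cat x i)"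
    unfolding num_value_eq_sum_count_vec[OF assms(1-3)] using assms(4) by (auto intro!: sum.cong)
  then show ?thesis
    unfolding sum_by_parts_tails tail_count_def .
qed

text \<open>
  The increments exist within the natural numbers because a numerical representation is increasing
  along \<open>\<eta>\<close>.
\<close>

lemma num_rep_weights:
  assumes "strict_mono_on {1..K} \<eta>" "\<nu> \<in> num_reps K \<eta>"
  obtains w where "\<And>i. i \<in> {1..K} \<Longrightarrow> \<nu> (\<eta> i) = (\<Sum>j=1..i. w j)"
proof -
  define w where "w j = (if j = 1 then \<nu> (\<eta> 1) else \<nu> (\<eta> j) - \<nu> (\<eta> (j - 1)))" for j
  have "\<nu> (\<eta> i) = (\<Sum>j=1..i. w j)" if "1 \<le> i" "i \<le> K" for i
    using that
  proof (induction i rule: dec_induct)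
    case base
    then show ?case by (simp add: w_def)
  next
    case (step n)
    then have "\<eta> n < \<eta> (Suc n)"
      using assms(1) by (auto simp: strict_mono_on_def)
    then have "\<nu> (\<eta> n) < \<nu> (\<eta> (Suc n))"
      using assms(2) step by (auto simp: num_reps_def)
    then show ?case using step by (simp add: w_def)
  qed
  then show thesis using that by auto
qed

lemma weights_num_rep:
  fixes w :: "nat \<Rightarrow> nat"
  assumes "strict_mono_on {1..K} \<eta>" "\<And>j. 0 < w j"
  obtains \<nu> where "\<nu> \<in> num_reps K \<eta>" "\<And>i. i \<in> {1..K} \<Longrightarrow> \<nu> (\<eta> i) = (\<Sum>j=1..i. w j)"
proof -
  define \<nu> where "\<nu> c = (\<Sum>j=1..inv_into {1..K} \<eta> c. w j)" for c
  have eq: "\<nu> (\<eta> i) = (\<Sum>j=1..i. w j)" if "i \<in> {1..K}" for i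
    using that inv_into_f_f[OF strict_mono_on_imp_inj_on[OF assms(1)]] by (simp add: \<nu>_def)
  have "strict_mono (\<lambda>i. \<Sum>j=1..i. w j)"
    using assms(2) by (simp add: strict_mono_Suc_iff)
  from strict_mono_less[OF this] have "\<nu> \<in> num_reps K \<eta>"
    using strict_mono_on_less[OF assms(1)] by (simp add: num_reps_def eq)
  then show thesis using that eq by blast
qed

theorem lemma9:
  fixes S :: "'a set" and X :: "'a set set" and K :: nat
    and \<eta> :: "nat \<Rightarrow> 'c::order" and cat :: "'a \<Rightarrow> 'c" and x' x_hat :: "'a set"
  assumes "1 \<le> K"
    and "strict_mono_on {1..K} \<eta>"
    and "cat \<in> S \<rightarrow> \<eta> ` {1..K}"
    and "X \<subseteq> Pow S"
    and "\<And>x. x \<in> X \<Longrightarrow> finite x"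
    and "x' \<in> X" and "x_hat \<in> X"
  shows "ordinally_dominates K \<eta> cat x' x_hat \<longleftrightarrow> tail_dominates K \<eta> cat x' x_hat"
proof -
  let ?T = "tail_count K \<eta> cat"
  have inj: "inj_on \<eta> {1..K}"
    using assms(2) by (rule strict_mono_on_imp_inj_on)
  have "cat ` x \<subseteq> \<eta> ` {1..K}" if "x \<in> X" for x
    using that assms(3,4) by blast
  note value_count = num_value_eq_sum_count_vec[OF assms(5) inj this]
    and value_tail = num_value_eq_sum_tail_count[OF assms(5) inj this]
  show ?thesis
  proof
    assume dom: "ordinally_dominates K \<eta> cat x' x_hat"
    then have weak: "num_value cat \<nu> x' \<le> num_value cat \<nu> x_hat" if "\<nu> \<in> num_reps K \<eta>" for \<nu>
      using that by (auto simp: ordinally_dominates_def weakly_ordinally_dominates_def)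
    have "?T x' j \<le> ?T x_hat j" if j: "j \<in> {1..K}" for j
    proof (rule ccontr)
      assume less: "\<not> ?T x' j \<le> ?T x_hat j"
      \<comment> \<open>With weight \<open>1 + M\<close> on \<open>j\<close>, the excess of at least \<open>1\<close> in the \<open>j\<close>-th tail contributes at
        least \<open>M\<close>, which exceeds everything that the unit weights can contribute to the value
        of \<open>x_hat\<close>.\<close>
      define M where "M = nat (1 + (\<Sum>k=1..K. ?T x_hat k))"
      have nonneg: "0 \<le> (\<Sum>k=1..K. ?T x k)" for x
        by (rule sum_nonneg) (rule tail_count_nonneg, simp)
      then have M: "int M = 1 + (\<Sum>k=1..K. ?T x_hat k)"
        by (simp add: M_def add_nonneg_nonneg)
      define w where "w k = 1 + (if k = j then M else 0)" for k
      obtain \<nu> where \<nu>: "\<nu> \<in> num_reps K \<eta>" "\<And>i. i \<in> {1..K} \<Longrightarrow> \<nu> (\<eta> i) = (\<Sum>k=1..i. w k)"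
        using weights_num_rep[OF assms(2), of w] by (auto simp: w_def)
      have val: "int (num_value cat \<nu> x) = (\<Sum>k=1..K. ?T x k) + int M * ?T x j" if "x \<in> X" for x
      proof -
        have "int (num_value cat \<nu> x) = (\<Sum>k=1..K. int (w k) * ?T x k)"
          using that \<nu>(2) by (intro value_tail) auto
        also have "\<dots> = (\<Sum>k=1..K. ?T x k + (if k = j then int M * ?T x k else 0))"
          by (rule sum.cong) (auto simp: w_def algebra_simps)
        finally show ?thesis using j by (simp add: sum.distrib)
      qed
      have "int M * (?T x_hat j + 1) \<le> int M * ?T x' j"
        using less by (intro mult_left_mono) auto
      then have "int M * ?T x_hat j + int M \<le> int M * ?T x' j"
        by (simp add: algebra_simps)
      then have "int (num_value cat \<nu> x_hat) < int (num_value cat \<nu> x')"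
        using val[OF assms(6)] val[OF assms(7)] M nonneg[of x'] by linarith
      then show False using weak[OF \<nu>(1)] by simp
    qed
    moreover have "count_vec K \<eta> cat x' \<noteq> count_vec K \<eta> cat x_hat"
    proof
      assume "count_vec K \<eta> cat x' = count_vec K \<eta> cat x_hat"
      then have "num_value cat \<nu> x' = num_value cat \<nu> x_hat" for \<nu>
        using value_count[OF assms(6,6), of \<nu>] value_count[OF assms(7,7), of \<nu>] by simp
      then show False using dom by (auto simp: ordinally_dominates_def)
    qed
    ultimately show "tail_dominates K \<eta> cat x' x_hat"
      by (simp add: tail_dominates_def tail_count_def)
  next
    assume dom: "tail_dominates K \<eta> cat x' x_hat"
    then have le: "?T x' j \<le> ?T x_hat j" if "j \<in> {1..K}" for j
      using that by (simp add: tail_dominates_def tail_count_def)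
    have "num_value cat \<nu> x' \<le> num_value cat \<nu> x_hat" if "\<nu> \<in> num_reps K \<eta>" for \<nu>
    proof -
      obtain w where w: "\<And>i. i \<in> {1..K} \<Longrightarrow> \<nu> (\<eta> i) = (\<Sum>j=1..i. w j)"
        using num_rep_weights[OF assms(2) \<open>\<nu> \<in> num_reps K \<eta>\<close>] by blast
      have val: "int (num_value cat \<nu> x) = (\<Sum>j=1..K. int (w j) * ?T x j)" if "x \<in> X" for x
        using that w by (intro value_tail) auto
      have "(\<Sum>j=1..K. int (w j) * ?T x' j) \<le> (\<Sum>j=1..K. int (w j) * ?T x_hat j)"
        using le by (intro sum_mono mult_left_mono) auto
      then have "int (num_value cat \<nu> x') \<le> int (num_value cat \<nu> x_hat)"
        using val assms(6,7) by simp
      then show ?thesis by simp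
    qed
    moreover have "\<exists>\<nu>\<in>num_reps K \<eta>. num_value cat \<nu> x' < num_value cat \<nu> x_hat"
    proof -
      obtain j where j: "j \<in> {1..K}" "?T x' j \<noteq> ?T x_hat j"
        using dom count_vec_eqI_tail_count[of K \<eta> cat x' x_hat] by (auto simp: tail_dominates_def)
      obtain \<nu> where \<nu>: "\<nu> \<in> num_reps K \<eta>" "\<And>i. i \<in> {1..K} \<Longrightarrow> \<nu> (\<eta> i) = (\<Sum>k=1..i. 1)"
        using weights_num_rep[OF assms(2), of "\<lambda>_. 1"] by auto
      have "(\<Sum>k=1..K. ?T x' k) < (\<Sum>k=1..K. ?T x_hat k)"
        using le j by (intro sum_strict_mono_ex1) (auto simp: less_le)
      moreover have "int (num_value cat \<nu> x) = (\<Sum>k=1..K. ?T x k)" if "x \<in> X" for x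
        using value_tail[of x \<nu> "\<lambda>_. 1"] that \<nu>(2) by simp
      ultimately have "int (num_value cat \<nu> x') < int (num_value cat \<nu> x_hat)"
        using assms(6,7) by simp
      then show ?thesis using \<nu>(1) by auto
    qed
    ultimately show "ordinally_dominates K \<eta> cat x' x_hat"
      by (simp add: ordinally_dominates_def weakly_ordinally_dominates_def)
  qed
qed

end
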